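(* Let $k,\ell$ be integers with $k,\ell\geq 2$ and $2k\geq \ell$. Then $$C(C_{2k},C_\ell)=\frac{4k(k-1)}{2k\ell-2k-\ell}.$$
   Context: All graphs are finite and simple. $C_m$ denotes the cycle on $m$ vertices for $m\geq 3$, and by convention $C_2=K_2$ is the single edge. $\operatorname{hom}(H,T)$ is the number of maps $V(H)\to V(T)$ sending every edge of $H$ to an edge of $T$, $t(H,T)=\operatorname{hom}(H,T)/v(T)^{v(H)}$, and $C(G,H)=\min\{c\in\mathbb{R}: t(G,T)\geq t(H,T)^c \text{ for all graphs } T\}$. *)

theory Defs
  imports "HOL-Analysis.Analysis" "Graph_Theory.Pair_Digraph"
begin

text \<open>
  A finite simple graph is a \<^const>\<open>pair_graph\<close>: an edge is represented by its two
  orientations, so an edge-preserving map is one that maps arcs to arcs.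
\<close>

definition graph_homs :: "'a pair_pre_digraph \<Rightarrow> 'b pair_pre_digraph \<Rightarrow> ('a \<Rightarrow> 'b) set" where
  "graph_homs H T =
     {f \<in> pverts H \<rightarrow>\<^sub>E pverts T. \<forall>u v. (u, v) \<in> parcs H \<longrightarrow> (f u, f v) \<in> parcs T}"

definition hom_count :: "'a pair_pre_digraph \<Rightarrow> 'b pair_pre_digraph \<Rightarrow> nat" where
  "hom_count H T = card (graph_homs H T)"

definition hom_density :: "'a pair_pre_digraph \<Rightarrow> 'b pair_pre_digraph \<Rightarrow> real" where
  "hom_density H T = real (hom_count H T) / real (card (pverts T)) ^ card (pverts H)"

text \<open>
  The target \<open>T\<close> ranges over graphs on finite nonempty sets of natural numbers; every finite
  nonempty graph is isomorphic to such a graph, and densities are isomorphism invariant.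
  \<open>0 powr c = 0\<close> holds for all \<open>c\<close>, also for \<open>c \<le> 0\<close>; this does not affect the set when \<open>G\<close>
  has an edge and some \<open>T\<close> has \<open>hom_density H T > 0\<close> and \<open>hom_density G T < 1\<close>
  (e.g. a large complete graph), since such a \<open>T\<close> already excludes all \<open>c \<le> 0\<close>.
\<close>

definition domination_exponents ::
    "'a pair_pre_digraph \<Rightarrow> 'b pair_pre_digraph \<Rightarrow> real set" where
  "domination_exponents G H =
     {c. \<forall>T :: nat pair_pre_digraph. pair_graph T \<and> pverts T \<noteq> {} \<longrightarrow>
           hom_density G T \<ge> hom_density H T powr c}"

text \<open>The minimum of the set; meaningful only if the minimum is attained.\<close>

definition domination_exponent ::
    "'a pair_pre_digraph \<Rightarrow> 'b pair_pre_digraph \<Rightarrow> real" where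
  "domination_exponent G H = (LEAST c. c \<in> domination_exponents G H)"

text \<open>For \<open>m \<ge> 3\<close> the cycle on \<open>m\<close> vertices, and for \<open>m = 2\<close> the single edge.\<close>

definition cycle_graph :: "nat \<Rightarrow> nat pair_pre_digraph" where
  "cycle_graph m =
     \<lparr>pverts = {..<m},
      parcs = {(i, j). i < m \<and> j < m \<and> (j = (i + 1) mod m \<or> i = (j + 1) mod m)}\<rparr>"

lemma pair_graph_cycle_graph:
  assumes "m \<ge> 2"
  shows "pair_graph (cycle_graph m)"
proof -
  have ne: "(i + 1) mod m \<noteq> i" if "i < m" for i
    using that assms by (cases "i + 1 = m") auto
  have fin: "finite (parcs (cycle_graph m))"
    by (rule finite_subset[of _ "{..<m} \<times> {..<m}"]) (auto simp: cycle_graph_def)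
  show ?thesis
  proof unfold_locales
    show "symmetric (with_proj (cycle_graph m))"
      by (auto simp: symmetric_def sym_def cycle_graph_def)
    show "fst e \<noteq> snd e" if "e \<in> parcs (cycle_graph m)" for e
      using that ne by (fastforce simp: cycle_graph_def)
  qed (use fin in \<open>auto simp: cycle_graph_def\<close>)
qed

lemma cycle_graph_2: "cycle_graph 2 = \<lparr>pverts = {0, 1}, parcs = {(0, 1), (1, 0)}\<rparr>"
  by (auto simp: cycle_graph_def less_2_cases_iff)

end

theory Submission
  imports Defs "Jordan_Normal_Form.Schur_Decomposition" "HOL-Number_Theory.Cong"
begin

text \<open>
  Let \<open>x\<^sub>1, \<dots>, x\<^sub>n\<close> be the eigenvalues of the adjacency matrix of \<open>T\<close>, divided by \<open>n\<close>. Closed walks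
  give \<open>t(C\<^sub>m, T) = \<Sum>\<^sub>i x\<^sub>i ^ m\<close> for all \<open>m \<ge> 2\<close>, including the edge \<open>m = 2\<close>, and the largest
  \<open>\<bar>x\<^sub>i\<bar>\<close> is at least the edge density \<open>\<Sum>\<^sub>i x\<^sub>i\<^sup>2\<close>. Interpolating the power sum of exponent \<open>l\<close> between
  those of exponents \<open>2\<close> and \<open>2k\<close> gives the upper bound.

  For the lower bound take the Cayley graph of \<open>F\<^sub>p ^ 2k\<close> whose connection set is the union of the
  \<open>p\<close> lines spanned by the points \<open>(1, a, \<dots>, a ^ (2k - 1))\<close> of the moment curve. Since any \<open>2k\<close> of
  these points are independent, the steps of a closed walk of length \<open>2k\<close> along each line sum to
  zero separately, so there are only \<open>O(p ^ 4k)\<close> such walks, while the closed walks of length \<open>l\<close>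
  inside single lines already number \<open>\<Omega>(p ^ (2k + l))\<close>. Now let \<open>p\<close> tend to infinity.
\<close>

section \<open>The spectrum of a symmetric kernel\<close>

no_notation Finite_Cartesian_Product.vec_nth (infixl \<open>$\<close> 90)

section \<open>Entrywise powers of a kernel on \<open>{..<n}\<close>\<close>

primrec kernel_pow :: "nat \<Rightarrow> (nat \<Rightarrow> nat \<Rightarrow> 'a::comm_semiring_1) \<Rightarrow> nat \<Rightarrow> nat \<Rightarrow> nat \<Rightarrow> 'a" where
  "kernel_pow n M 0 i j = (if i = j then 1 else 0)"
| "kernel_pow n M (Suc m) i j = (\<Sum>v<n. kernel_pow n M m i v * M v j)"

lemma kernel_pow_1: "i < n \<Longrightarrow> kernel_pow n M 1 i j = M i j"
  by (simp add: if_distrib[of "\<lambda>x. x * _"] cong: if_cong)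

lemma kernel_pow_add:
  "j < n \<Longrightarrow> kernel_pow n M (a + b) i j = (\<Sum>v<n. kernel_pow n M a i v * kernel_pow n M b v j)"
proof (induction b arbitrary: j)
  case 0
  then show ?case
    by (simp add: if_distrib[of "\<lambda>x. _ * x"] cong: if_cong)
next
  case (Suc b)
  have "kernel_pow n M (a + Suc b) i j
      = (\<Sum>u<n. (\<Sum>v<n. kernel_pow n M a i v * kernel_pow n M b v u) * M u j)"
    using Suc.IH by simp
  also have "\<dots> = (\<Sum>u<n. \<Sum>v<n. kernel_pow n M a i v * (kernel_pow n M b v u * M u j))"
    by (simp add: sum_distrib_right mult.assoc)
  also have "\<dots> = (\<Sum>v<n. \<Sum>u<n. kernel_pow n M a i v * (kernel_pow n M b v u * M u j))"
    by (rule sum.swap)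
  finally show ?case
    by (simp add: sum_distrib_left)
qed

lemma kernel_pow_sym:
  assumes sym: "\<And>i j. i < n \<Longrightarrow> j < n \<Longrightarrow> M i j = M j i"
  shows "i < n \<Longrightarrow> j < n \<Longrightarrow> kernel_pow n M m i j = kernel_pow n M m j i"
proof (induction m arbitrary: i j)
  case (Suc m)
  have "kernel_pow n M (Suc m) i j = (\<Sum>v<n. kernel_pow n M 1 j v * kernel_pow n M m v i)"
    using Suc sym by (auto simp: kernel_pow_1 mult.commute simp del: One_nat_def intro!: sum.cong)
  also have "\<dots> = kernel_pow n M (1 + m) j i"
    using Suc.prems by (simp only: kernel_pow_add)
  finally show ?case by simp
qed auto

lemma pow_mat_eq_kernel_pow:
  "i < n \<Longrightarrow> j < n \<Longrightarrow>
    (mat n n (\<lambda>(i, j). of_real (M i j)) ^\<^sub>m m) $$ (i, j)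
      = (of_real (kernel_pow n M m i j) :: complex)"
proof (induction m arbitrary: i j)
  case (Suc m)
  let ?A = "mat n n (\<lambda>(i, j). of_real (M i j)) :: complex mat"
  have c: "?A \<in> carrier_mat n n" "?A ^\<^sub>m m \<in> carrier_mat n n" by (auto intro!: pow_carrier_mat)
  have "(?A ^\<^sub>m m * ?A) $$ (i, j) = (\<Sum>v<n. (?A ^\<^sub>m m) $$ (i, v) * ?A $$ (v, j))"
    using Suc.prems c by (subst index_mult_mat) (auto simp: scalar_prod_def lessThan_atLeast0)
  then show ?case using Suc by simp
qed (auto simp: one_mat_def)

section \<open>Traces, triangular matrices and real eigenvalues\<close>

lemma sum_diag_mult_comm:
  fixes X Y :: "'a::comm_semiring_0 mat"
  assumes "X \<in> carrier_mat n n" "Y \<in> carrier_mat n n"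
  shows "(\<Sum>i<n. (X * Y) $$ (i, i)) = (\<Sum>i<n. (Y * X) $$ (i, i))"
proof -
  have e: "(\<Sum>i<n. (X * Y) $$ (i, i)) = (\<Sum>i<n. \<Sum>j<n. X $$ (i, j) * Y $$ (j, i))"
    if "X \<in> carrier_mat n n" "Y \<in> carrier_mat n n" for X Y :: "'a mat"
    using that by (auto simp: scalar_prod_def lessThan_atLeast0 intro!: sum.cong)
  show ?thesis
    unfolding e[OF assms] e[OF assms(2,1)] by (subst sum.swap) (simp add: mult.commute)
qed

lemma upper_triangular_pow:
  fixes B :: "'a::comm_semiring_1 mat"
  assumes B: "B \<in> carrier_mat n n" "upper_triangular B"
  shows "upper_triangular (B ^\<^sub>m m) \<and> (\<forall>i<n. (B ^\<^sub>m m) $$ (i, i) = B $$ (i, i) ^ m)"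
proof (induction m)
  case (Suc m)
  have c: "B ^\<^sub>m m \<in> carrier_mat n n" using B by (auto intro!: pow_carrier_mat)
  have e: "(B ^\<^sub>m m * B) $$ (i, j) = (B ^\<^sub>m m) $$ (i, i) * B $$ (i, j)"
    if "j \<le> i" "i < n" for i j
  proof -
    \<comment> \<open>On or below the diagonal only the term \<open>v = i\<close> of the product
      survives: for \<open>v < i\<close> the left factor lies below the diagonal, for
      \<open>v > i \<ge> j\<close> the right factor does.\<close>
    have "(B ^\<^sub>m m) $$ (i, v) * B $$ (v, j) = 0" if "v < n" "v \<noteq> i" for v
    proof (cases "v < i")
      case True
      then show ?thesis using Suc c \<open>i < n\<close> by (auto simp: upper_triangular_def)
    next
      case False
      then show ?thesis using that \<open>j \<le> i\<close> B by (auto simp: upper_triangular_def)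
    qed
    then have "(\<Sum>v<n. (B ^\<^sub>m m) $$ (i, v) * B $$ (v, j))
        = (\<Sum>v\<in>{i}. (B ^\<^sub>m m) $$ (i, v) * B $$ (v, j))"
      using that by (intro sum.mono_neutral_right) auto
    then show ?thesis
      using that B c by (subst index_mult_mat) (auto simp: scalar_prod_def lessThan_atLeast0)
  qed
  show ?case
    using e Suc B c by (auto simp: upper_triangular_def mult.commute)
qed (use B in \<open>auto simp: upper_triangular_def\<close>)

text \<open>The Hermitian form \<open>Q\<close> of an eigenvector equals \<open>e\<close> times its
  squared norm \<open>N > 0\<close>, and swapping the two summations shows that \<open>Q\<close> is
  its own conjugate.\<close>

lemma eigenvalue_real_symmetric:
  assumes sym: "\<And>i j. i < n \<Longrightarrow> j < n \<Longrightarrow> M i j = (M j i :: real)"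
    and ev: "eigenvalue (mat n n (\<lambda>(i, j). complex_of_real (M i j))) e"
  shows "e \<in> \<real>"
proof -
  let ?A = "mat n n (\<lambda>(i, j). complex_of_real (M i j))"
  obtain v where v: "v \<in> carrier_vec n" "v \<noteq> 0\<^sub>v n" "?A *\<^sub>v v = e \<cdot>\<^sub>v v"
    using ev by (auto simp: eigenvalue_def eigenvector_def)
  define x where "x i = v $ i" for i
  have eq: "(\<Sum>j<n. of_real (M i j) * x j) = e * x i" if "i < n" for i
  proof -
    have "(?A *\<^sub>v v) $ i = (\<Sum>j<n. of_real (M i j) * x j)"
      using that v(1) by (auto simp: scalar_prod_def lessThan_atLeast0 x_def intro!: sum.cong)
    then show ?thesis using v that by (simp add: x_def)
  qed
  define N where "N = (\<Sum>i<n. (cmod (x i))\<^sup>2)"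
  have N: "N > 0"
  proof -
    obtain i where "i < n" "x i \<noteq> 0"
      using v(1,2) by (metis carrier_vecD eq_vecI index_zero_vec x_def)
    then show ?thesis unfolding N_def by (intro sum_pos2[of _ i]) auto
  qed
  define Q where "Q = (\<Sum>i<n. \<Sum>j<n. cnj (x i) * of_real (M i j) * x j)"
  have "Q = (\<Sum>i<n. cnj (x i) * (e * x i))"
    unfolding Q_def by (intro sum.cong refl) (simp add: eq[symmetric] sum_distrib_left mult.assoc)
  also have "\<dots> = (\<Sum>i<n. e * of_real ((cmod (x i))\<^sup>2))"
    unfolding complex_norm_square by (simp add: mult_ac)
  also have "\<dots> = e * of_real N"
    by (simp add: N_def sum_distrib_left)
  finally have "Q = e * of_real N" .
  moreover have "cnj Q = (\<Sum>i<n. \<Sum>j<n. cnj (x j) * of_real (M j i) * x i)"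
    unfolding Q_def using sym by (auto intro!: sum.cong simp: mult_ac)
  then have "cnj Q = Q"
    unfolding Q_def by (subst (asm) sum.swap)
  ultimately have "cnj e * of_real N = e * of_real N" by simp
  then have "cnj e = e" using N by simp
  then show ?thesis by (simp add: Reals_cnj_iff)
qed

text \<open>Triangularize over the complex numbers: conjugation preserves the trace of every power,
  and the diagonal of \<open>B ^\<^sub>m m\<close> consists of \<open>m\<close>-th powers. Thus a
  single list \<open>ev\<close> serves all exponents \<open>m\<close> at once.\<close>

lemma symmetric_kernel_spectrum:
  assumes sym: "\<And>i j. i < n \<Longrightarrow> j < n \<Longrightarrow> M i j = (M j i :: real)"
  obtains ev :: "nat \<Rightarrow> real"
  where "\<And>m. (\<Sum>i<n. kernel_pow n M m i i) = (\<Sum>i<n. ev i ^ m)"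
proof -
  let ?A = "mat n n (\<lambda>(i, j). complex_of_real (M i j))"
  have A: "?A \<in> carrier_mat n n" by simp
  obtain es where es: "char_poly ?A = (\<Prod>a\<leftarrow>es. [:- a, 1:])" "length es = n"
    using char_poly_factorized[OF A] by blast
  obtain B P Q where sd: "schur_decomposition ?A es = (B, P, Q)"
    by (cases "schur_decomposition ?A es") auto
  have sim: "similar_mat_wit ?A B P Q" and ut: "upper_triangular B" and diag: "diag_mat B = es"
    using schur_decomposition[OF A es(1) sd] by auto
  note simD = similar_mat_witD2[OF A sim]
  have c: "B \<in> carrier_mat n n" "P \<in> carrier_mat n n" "Q \<in> carrier_mat n n"
    "\<And>m. B ^\<^sub>m m \<in> carrier_mat n n"
    using simD by (auto intro!: pow_carrier_mat)
  \<comment> \<open>The diagonal of \<open>B\<close> lists roots of the characteristic polynomial,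
    hence real eigenvalues, so passing to \<open>Re\<close> loses nothing.\<close>
  have Bii: "B $$ (i, i) = of_real (Re (B $$ (i, i)))" if "i < n" for i
  proof -
    have "B $$ (i, i) \<in> set es"
      using that c(1) unfolding diag[symmetric] by (auto simp: diag_mat_def)
    then have "poly (char_poly ?A) (B $$ (i, i)) = 0"
      unfolding es by (auto simp: poly_prod_list prod_list_zero_iff)
    then have "eigenvalue ?A (B $$ (i, i))"
      using eigenvalue_root_char_poly[OF A] by blast
    then show ?thesis
      using eigenvalue_real_symmetric[OF sym] by simp
  qed
  have "(\<Sum>i<n. kernel_pow n M m i i) = (\<Sum>i<n. Re (B $$ (i, i)) ^ m)" for m
  proof -
    have "complex_of_real (\<Sum>i<n. kernel_pow n M m i i) = (\<Sum>i<n. (?A ^\<^sub>m m) $$ (i, i))"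
      by (simp add: pow_mat_eq_kernel_pow)
    also have "?A ^\<^sub>m m = P * (B ^\<^sub>m m * Q)"
      using similar_mat_wit_pow_id[OF sim] c by (simp add: assoc_mult_mat[of _ n n _ n _ n])
    also have "(\<Sum>i<n. (P * (B ^\<^sub>m m * Q)) $$ (i, i)) = (\<Sum>i<n. (B ^\<^sub>m m * Q * P) $$ (i, i))"
      using c by (intro sum_diag_mult_comm[of _ n]) auto
    also have "B ^\<^sub>m m * Q * P = B ^\<^sub>m m"
      using c simD by (simp add: assoc_mult_mat[of _ n n _ n _ n])
    also have "(\<Sum>i<n. (B ^\<^sub>m m) $$ (i, i)) = (\<Sum>i<n. of_real (Re (B $$ (i, i)) ^ m))"
      using upper_triangular_pow[OF c(1) ut, of m] Bii by (intro sum.cong) auto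
    finally show ?thesis
      by (simp only: of_real_sum[symmetric] of_real_eq_iff)
  qed
  then show thesis by (rule that)
qed

text \<open>By symmetry the entries of the \<open>2 * m\<close>-th power sum to the sum of the
  squared row sums of the \<open>m\<close>-th power; then Cauchy-Schwarz over the \<open>n\<close>
  rows.\<close>

lemma sum_kernel_pow_double:
  assumes sym: "\<And>i j. i < n \<Longrightarrow> j < n \<Longrightarrow> M i j = (M j i :: real)"
  shows "(\<Sum>i<n. \<Sum>j<n. kernel_pow n M m i j)\<^sup>2
      \<le> real n * (\<Sum>i<n. \<Sum>j<n. kernel_pow n M (2 * m) i j)"
proof -
  have "(\<Sum>i<n. \<Sum>j<n. kernel_pow n M (2 * m) i j)
      = (\<Sum>i<n. \<Sum>j<n. \<Sum>v<n. kernel_pow n M m v i * kernel_pow n M m v j)"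
    unfolding mult_2 by (intro sum.cong refl)
      (auto simp: kernel_pow_add intro!: sum.cong kernel_pow_sym sym)
  also have "\<dots> = (\<Sum>i<n. \<Sum>v<n. \<Sum>j<n. kernel_pow n M m v i * kernel_pow n M m v j)"
    by (intro sum.cong refl sum.swap)
  also have "\<dots> = (\<Sum>v<n. \<Sum>i<n. \<Sum>j<n. kernel_pow n M m v i * kernel_pow n M m v j)"
    by (rule sum.swap)
  also have "\<dots> = (\<Sum>v<n. (\<Sum>j<n. kernel_pow n M m v j)\<^sup>2)"
    by (simp add: power2_eq_square sum_product)
  finally show ?thesis
    using sum_squared_le_sum_of_squares[of "\<lambda>v. \<Sum>j<n. kernel_pow n M m v j" "{..<n}"]
    by (simp add: mult.commute)
qed

text \<open>The trace of the \<open>2 * m\<close>-th power is the squared Frobenius norm of the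
  \<open>m\<close>-th power; then Cauchy-Schwarz over all \<open>n\<close> times \<open>n\<close>
  entries.\<close>

lemma trace_kernel_pow_double:
  assumes sym: "\<And>i j. i < n \<Longrightarrow> j < n \<Longrightarrow> M i j = (M j i :: real)"
  shows "(\<Sum>i<n. \<Sum>j<n. kernel_pow n M m i j)\<^sup>2
      \<le> (real n)\<^sup>2 * (\<Sum>i<n. kernel_pow n M (2 * m) i i)"
proof -
  have "(\<Sum>i<n. kernel_pow n M (2 * m) i i) = (\<Sum>i<n. \<Sum>j<n. (kernel_pow n M m i j)\<^sup>2)"
    unfolding mult_2 power2_eq_square by (intro sum.cong refl)
      (auto simp: kernel_pow_add intro!: sum.cong kernel_pow_sym sym)
  then have "(\<Sum>i<n. kernel_pow n M (2 * m) i i)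
      = (\<Sum>z\<in>{..<n} \<times> {..<n}. (kernel_pow n M m (fst z) (snd z))\<^sup>2)"
    by (simp add: sum.cartesian_product case_prod_beta)
  then show ?thesis
    using sum_squared_le_sum_of_squares[of "\<lambda>z. kernel_pow n M m (fst z) (snd z)"
        "{..<n} \<times> {..<n}"]
    by (simp add: sum.cartesian_product case_prod_beta power2_eq_square mult_ac)
qed

text \<open>Counts weighted walks from below in terms of the average row sum \<open>d\<close>.
  Exponents are powers of two because the induction step is the doubling inequality; they are
  unbounded, which is what the limit argument below requires.\<close>

lemma sum_kernel_pow_two_power:
  assumes sym: "\<And>i j. i < n \<Longrightarrow> j < n \<Longrightarrow> M i j = (M j i :: real)"
    and n: "n > 0" and d: "(\<Sum>i<n. \<Sum>j<n. M i j) = real n * d" "d \<ge> 0"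
  shows "real n * d ^ (2 ^ r) \<le> (\<Sum>i<n. \<Sum>j<n. kernel_pow n M (2 ^ r) i j)"
proof (induction r)
  case 0
  then show ?case using d kernel_pow_1[of _ n M] by simp
next
  case (Suc r)
  have "(real n * d ^ (2 ^ r))\<^sup>2 \<le> (\<Sum>i<n. \<Sum>j<n. kernel_pow n M (2 ^ r) i j)\<^sup>2"
    using Suc d by (intro power_mono) auto
  also have "\<dots> \<le> real n * (\<Sum>i<n. \<Sum>j<n. kernel_pow n M (2 * 2 ^ r) i j)"
    by (rule sum_kernel_pow_double[OF sym])
  also have "(real n * d ^ (2 ^ r))\<^sup>2 = real n * (real n * d ^ (2 ^ Suc r))"
    by (simp add: power_mult_distrib power2_eq_square[of "real n"] power_mult[symmetric] mult.commute)
  finally have "real n * (real n * d ^ (2 ^ Suc r))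
      \<le> real n * (\<Sum>i<n. \<Sum>j<n. kernel_pow n M (2 ^ Suc r) i j)"
    by simp
  then show ?case using n by simp
qed

text \<open>If the largest absolute value \<rho> were below \<open>d\<close>, the two doubling
  inequalities would give \<open>d ^ s \<le> n * \<rho> ^ s\<close> for every
  \<open>s = 2 * 2 ^ r\<close>. The factor \<open>n\<close> cannot absorb the exponential growth of
  \<open>(d / \<rho>) ^ s\<close>.\<close>

lemma spectrum_ge_average_row_sum:
  assumes sym: "\<And>i j. i < n \<Longrightarrow> j < n \<Longrightarrow> M i j = (M j i :: real)"
    and n: "n > 0" and d: "(\<Sum>i<n. \<Sum>j<n. M i j) = real n * d" "d \<ge> 0"
    and ev: "\<And>m. (\<Sum>i<n. kernel_pow n M m i i) = (\<Sum>i<n. ev i ^ m)"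
  shows "\<exists>i<n. d \<le> \<bar>ev i\<bar>"
proof (rule ccontr)
  assume neg: "\<not> ?thesis"
  define \<rho> where "\<rho> = Max ((\<lambda>i. \<bar>ev i\<bar>) ` {..<n})"
  have ge: "\<bar>ev i\<bar> \<le> \<rho>" if "i < n" for i
    unfolding \<rho>_def using that by (intro Max_ge) auto
  have "\<rho> \<in> (\<lambda>i. \<bar>ev i\<bar>) ` {..<n}"
    unfolding \<rho>_def using n by (intro Max_in) auto
  then have \<rho>: "0 \<le> \<rho>" "\<rho> < d" using neg by auto
  have bound: "d ^ (2 * 2 ^ r) \<le> real n * \<rho> ^ (2 * 2 ^ r)" for r
  proof -
    have "(real n * d ^ (2 ^ r))\<^sup>2 \<le> (\<Sum>i<n. \<Sum>j<n. kernel_pow n M (2 ^ r) i j)\<^sup>2"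
      using sum_kernel_pow_two_power[OF sym n d] d by (intro power_mono) auto
    also have "\<dots> \<le> (real n)\<^sup>2 * (\<Sum>i<n. ev i ^ (2 * 2 ^ r))"
      unfolding ev[symmetric] by (rule trace_kernel_pow_double[OF sym])
    also have "(real n * d ^ (2 ^ r))\<^sup>2 = (real n)\<^sup>2 * d ^ (2 * 2 ^ r)"
      by (simp add: power_mult_distrib power_mult[symmetric] mult.commute)
    finally have "d ^ (2 * 2 ^ r) \<le> (\<Sum>i<n. ev i ^ (2 * 2 ^ r))"
      using n by simp
    also have "\<dots> = (\<Sum>i<n. \<bar>ev i\<bar> ^ (2 * 2 ^ r))"
      by (simp add: power_even_abs)
    also have "\<dots> \<le> (\<Sum>i<n. \<rho> ^ (2 * 2 ^ r))"
      using ge by (intro sum_mono power_mono) auto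
    finally show ?thesis by simp
  qed
  show False
  proof (cases "\<rho> = 0")
    case True
    then show False using bound[of 0] \<rho> by simp
  next
    case False
    then have "1 < d / \<rho>" "\<rho> > 0" using \<rho> by auto
    then obtain r where r: "real n < (d / \<rho>) ^ r" using real_arch_pow by blast
    have "r \<le> 2 * 2 ^ r" using less_exp[of r] by linarith
    then have "(d / \<rho>) ^ r \<le> (d / \<rho>) ^ (2 * 2 ^ r)"
      using \<open>1 < d / \<rho>\<close> by (intro power_increasing) auto
    with r have "real n < d ^ (2 * 2 ^ r) / \<rho> ^ (2 * 2 ^ r)"
      by (simp add: power_divide)
    then have "real n * \<rho> ^ (2 * 2 ^ r) < d ^ (2 * 2 ^ r)"
      using \<open>\<rho> > 0\<close> by (simp add: pos_less_divide_eq)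
    then show False using bound[of r] by simp
  qed
qed

section \<open>Interpolation between power sums\<close>

lemma cycle_exponent_denominator_pos:
  fixes k l :: nat
  assumes "k \<ge> 2" "l \<ge> 2"
  shows "2 * real k * real l - 2 * real k - real l > 0"
proof -
  have "2 * real k * (real l - 1) \<ge> 4 * (real l - 1)" using assms by (intro mult_right_mono) auto
  moreover have "real l \<ge> 2" using assms by simp
  ultimately show ?thesis by (simp add: algebra_simps)
qed

text \<open>Write \<open>l = 2 * \<theta> + 2 * k * \<eta>\<close> with weights \<theta> and \<eta>
  adding up to 1. Hoelder bounds the power sum of exponent \<open>l\<close> by
  \<open>s powr \<theta> * q powr \<eta>\<close>, and assumption \<open>sq\<close> says
  \<open>s \<le> q powr (1 / (2 * k))\<close>. Together this is \<open>q\<close> to the power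
  \<open>\<theta> / (2 * k) + \<eta>\<close>, whose reciprocal is the claimed exponent.\<close>

lemma sum_power_interpolation:
  fixes x :: "nat \<Rightarrow> real"
  assumes kl: "k \<ge> 2" "l \<ge> 2" "l \<le> 2 * k"
    and x: "\<And>i. i < n \<Longrightarrow> x i \<ge> 0"
    and sq: "(\<Sum>i<n. x i ^ 2) ^ (2 * k) \<le> (\<Sum>i<n. x i ^ (2 * k))"
  shows "(\<Sum>i<n. x i ^ l) powr
      (4 * real k * (real k - 1) / (2 * real k * real l - 2 * real k - real l))
      \<le> (\<Sum>i<n. x i ^ (2 * k))"
proof -
  define s where "s = (\<Sum>i<n. x i ^ 2)"
  define q where "q = (\<Sum>i<n. x i ^ (2 * k))"
  define \<theta> where "\<theta> = (2 * real k - real l) / (2 * real k - 2)"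
  define \<eta> where "\<eta> = (real l - 2) / (2 * real k - 2)"
  define c where "c = 4 * real k * (real k - 1) / (2 * real k * real l - 2 * real k - real l)"
  have den: "2 * real k - 2 > 0" using kl by simp
  have th: "\<theta> \<ge> 0" "\<eta> \<ge> 0" "\<theta> + \<eta> = 1"
    using kl den by (auto simp: \<theta>_def \<eta>_def add_divide_distrib[symmetric])
  have "2 * \<theta> + real (2 * k) * \<eta> = real l * (2 * real k - 2) / (2 * real k - 2)"
    unfolding \<theta>_def \<eta>_def times_divide_eq_right add_divide_distrib[symmetric]
    by (simp add: algebra_simps)
  then have ex: "2 * \<theta> + real (2 * k) * \<eta> = real l"
    using den by simp
  note den2 = cycle_exponent_denominator_pos[OF kl(1,2)]
  have c: "(\<theta> / (2 * real k) + \<eta>) * c = 1" "c > 0"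
  proof -
    have "\<theta> / (2 * real k) + \<eta> = (2 * real k - real l) / (2 * real k * (2 * real k - 2))
        + 2 * real k * (real l - 2) / (2 * real k * (2 * real k - 2))"
      using kl unfolding \<theta>_def \<eta>_def by (subst mult_divide_mult_cancel_left) (auto simp: mult_ac)
    also have "\<dots> = (2 * real k * real l - 2 * real k - real l) / (4 * real k * (real k - 1))"
      unfolding add_divide_distrib[symmetric] by (simp add: algebra_simps)
    finally have "\<theta> / (2 * real k) + \<eta>
        = (2 * real k * real l - 2 * real k - real l) / (4 * real k * (real k - 1))" .
    then show "(\<theta> / (2 * real k) + \<eta>) * c = 1"
      unfolding c_def using den2 kl by simp
    show "c > 0" unfolding c_def using den2 kl by simp
  qed
  have "(\<Sum>i<n. x i ^ l) powr c \<le> q"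
  proof (cases "\<exists>i<n. x i \<noteq> 0")
    case False
    \<comment> \<open>All terms vanish, and \<open>0 powr c = 0\<close>.\<close>
    then show ?thesis using kl by (simp add: q_def power_0_left)
  next
    case True
    then obtain i0 where i0: "i0 < n" "x i0 > 0" using x by force
    have s: "s > 0" unfolding s_def using i0 x by (intro sum_pos2[of _ i0]) auto
    have q: "q > 0" unfolding q_def using i0 x by (intro sum_pos2[of _ i0]) auto
    \<comment> \<open>Hoelder term by term: after normalizing by \<open>s\<close> and
      \<open>q\<close>, weighted AM-GM applies to each index, and the right-hand sides add up to
      \<open>\<theta> + \<eta> = 1\<close>.\<close>
    have "x i ^ l / (s powr \<theta> * q powr \<eta>) \<le> \<theta> * (x i ^ 2 / s) + \<eta> * (x i ^ (2 * k) / q)"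
      if "i < n" for i
    proof (cases "x i = 0")
      case True
      then show ?thesis using kl by (simp add: power_0_left)
    next
      case False
      then have xi: "x i > 0" using x that by force
      have pw: "(x i ^ m) powr u = x i powr (real m * u)" for m u
        unfolding powr_realpow[OF xi, symmetric] powr_powr ..
      have "x i ^ l = x i powr (2 * \<theta> + real (2 * k) * \<eta>)"
        unfolding ex using xi by (simp add: powr_realpow)
      also have "\<dots> = (x i ^ 2) powr \<theta> * (x i ^ (2 * k)) powr \<eta>"
        unfolding pw powr_add by simp
      finally have "x i ^ l / (s powr \<theta> * q powr \<eta>)
          = (x i ^ 2 / s) powr \<theta> * (x i ^ (2 * k) / q) powr \<eta>"
        using xi s q by (simp add: powr_divide)
      also have "\<dots> \<le> \<theta> * (x i ^ 2 / s) + \<eta> * (x i ^ (2 * k) / q)"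
        using xi s q th by (intro Youngs_inequality_0) auto
      finally show ?thesis .
    qed
    then have "(\<Sum>i<n. x i ^ l / (s powr \<theta> * q powr \<eta>))
        \<le> (\<Sum>i<n. \<theta> * (x i ^ 2 / s) + \<eta> * (x i ^ (2 * k) / q))"
      by (intro sum_mono) auto
    also have "\<dots> = \<theta> * (s / s) + \<eta> * (q / q)"
      by (simp only: sum.distrib sum_distrib_left[symmetric] sum_divide_distrib[symmetric]
          s_def[symmetric] q_def[symmetric])
    also have "\<dots> = 1" using s q th by simp
    finally have "(\<Sum>i<n. x i ^ l) \<le> s powr \<theta> * q powr \<eta>"
      using s q by (simp add: sum_divide_distrib[symmetric] divide_le_eq)
    also have "s \<le> q powr (1 / (2 * real k))"
    proof -
      have "s = s powr (real (2 * k) * (1 / (2 * real k)))"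
        using s kl by simp
      also have "\<dots> = (s ^ (2 * k)) powr (1 / (2 * real k))"
        unfolding powr_realpow[OF s, symmetric] powr_powr ..
      also have "\<dots> \<le> q powr (1 / (2 * real k))"
        using sq s by (intro powr_mono2) (auto simp: s_def q_def)
      finally show ?thesis .
    qed
    then have "s powr \<theta> * q powr \<eta> \<le> (q powr (1 / (2 * real k))) powr \<theta> * q powr \<eta>"
      using s th by (intro mult_right_mono powr_mono2) auto
    also have "\<dots> = q powr (\<theta> / (2 * real k) + \<eta>)"
      by (simp add: powr_powr powr_add)
    finally have "(\<Sum>i<n. x i ^ l) powr c \<le> (q powr (\<theta> / (2 * real k) + \<eta>)) powr c"
      using x c by (intro powr_mono2) (auto intro!: sum_nonneg)
    also have "\<dots> = q" using q c by (simp add: powr_powr)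
    finally show ?thesis .
  qed
  then show ?thesis by (simp add: c_def q_def)
qed

section \<open>Cycle densities as power sums\<close>

text \<open>Since \<open>T\<close> is symmetric, checking one orientation of each cycle edge
  suffices. For \<open>m = 2\<close> the two conditions are the two orientations of the single edge,
  so \<open>K_2\<close> is treated like a cycle of length 2 from here on.\<close>

lemma graph_homs_cycle_graph:
  assumes "pair_graph T" "m \<ge> 2"
  shows "graph_homs (cycle_graph m) T
    = {f \<in> {..<m} \<rightarrow>\<^sub>E pverts T. \<forall>i<m. (f i, f (Suc i mod m)) \<in> parcs T}"
proof -
  interpret pair_graph T by fact
  have sym: "(v, u) \<in> parcs T" if "(u, v) \<in> parcs T" for u v
    using that by (simp add: arcs_symmetric)
  show ?thesis
    using assms(2) by (auto simp: graph_homs_def cycle_graph_def intro: sym)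
qed

section \<open>Invariance of densities under relabelling of the target\<close>

lemma hom_count_image:
  fixes h :: "'b \<Rightarrow> 'c"
  assumes h: "bij_betw h (pverts T) V" and H: "pair_wf_digraph H" and T: "pair_wf_digraph T"
  shows "hom_count H \<lparr>pverts = V, parcs = map_prod h h ` parcs T\<rparr> = hom_count H T"
proof -
  let ?T' = "\<lparr>pverts = V, parcs = map_prod h h ` parcs T\<rparr>"
  let ?g = "inv_into (pverts T) h"
  have inj: "inj_on h (pverts T)" and im: "h ` pverts T = V"
    using h by (auto simp: bij_betw_def)
  have Hw: "u \<in> pverts H \<and> v \<in> pverts H" if "(u, v) \<in> parcs H" for u v
    using pair_wf_digraph.arc_fst_in_verts[OF H that] pair_wf_digraph.arc_snd_in_verts[OF H that]
    by simp
  have Tw: "u \<in> pverts T \<and> v \<in> pverts T" if "(u, v) \<in> parcs T" for u v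
    using pair_wf_digraph.arc_fst_in_verts[OF T that] pair_wf_digraph.arc_snd_in_verts[OF T that]
    by simp
  have g_arc: "(?g x, ?g y) \<in> parcs T" if "(x, y) \<in> map_prod h h ` parcs T" for x y
    using that Tw inj by auto
  have gV: "?g x \<in> pverts T" if "x \<in> V" for x
    using that im inv_into_into by metis
  have "bij_betw (\<lambda>f. restrict (h \<circ> f) (pverts H)) (graph_homs H T) (graph_homs H ?T')"
  proof (rule bij_betw_byWitness[where f' = "\<lambda>f. restrict (?g \<circ> f) (pverts H)"])
    show "\<forall>f\<in>graph_homs H T. restrict (?g \<circ> restrict (h \<circ> f) (pverts H)) (pverts H) = f"
      using inj by (auto simp: graph_homs_def fun_eq_iff PiE_def extensional_def Pi_def)
    show "\<forall>f\<in>graph_homs H ?T'. restrict (h \<circ> restrict (?g \<circ> f) (pverts H)) (pverts H) = f"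
      using im by (auto simp: graph_homs_def fun_eq_iff PiE_def extensional_def Pi_def
          f_inv_into_f)
    show "(\<lambda>f. restrict (h \<circ> f) (pverts H)) ` graph_homs H T \<subseteq> graph_homs H ?T'"
      using im Hw by (auto simp: graph_homs_def PiE_def Pi_def intro!: map_prod_imageI)
    show "(\<lambda>f. restrict (?g \<circ> f) (pverts H)) ` graph_homs H ?T' \<subseteq> graph_homs H T"
      using gV g_arc Hw by (auto simp: graph_homs_def PiE_def Pi_def)
  qed
  then show ?thesis
    unfolding hom_count_def by (metis bij_betw_same_card)
qed

lemma pair_graph_image:
  fixes h :: "'b \<Rightarrow> 'c"
  assumes T: "pair_graph T" and h: "bij_betw h (pverts T) V"
  shows "pair_graph \<lparr>pverts = V, parcs = map_prod h h ` parcs T\<rparr>"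
proof -
  interpret pair_graph T by fact
  have inj: "inj_on h (pverts T)" and im: "h ` pverts T = V"
    using h by (auto simp: bij_betw_def)
  have Tw: "u \<in> pverts T" "v \<in> pverts T" "u \<noteq> v" "(v, u) \<in> parcs T" if "(u, v) \<in> parcs T" for u v
    using arc_fst_in_verts[OF that] arc_snd_in_verts[OF that] no_loops[OF that] arcs_symmetric[OF that]
    by auto
  show ?thesis
  proof unfold_locales
    show "symmetric (with_proj \<lparr>pverts = V, parcs = map_prod h h ` parcs T\<rparr>)"
      unfolding symmetric_def sym_def using Tw(4)
      by (auto intro!: map_prod_imageI)
    show "fst e \<noteq> snd e" if "e \<in> parcs \<lparr>pverts = V, parcs = map_prod h h ` parcs T\<rparr>" for e
      using that Tw inj_onD[OF inj] by fastforce
  qed (use Tw im in auto)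
qed

lemma hom_density_image:
  assumes T: "pair_graph T" and h: "bij_betw h (pverts T) V" and H: "pair_graph H"
  shows "hom_density H \<lparr>pverts = V, parcs = map_prod h h ` parcs T\<rparr> = hom_density H T"
proof -
  interpret T: pair_graph T by fact
  interpret H: pair_graph H by fact
  have "pair_wf_digraph H" "pair_wf_digraph T" by unfold_locales
  then show ?thesis
    using bij_betw_same_card[OF h] by (simp add: hom_density_def hom_count_image[OF h])
qed

text \<open>The recursion of \<open>kernel_pow\<close> splits a walk at its last but one vertex
  \<open>v\<close>.\<close>

lemma kernel_pow_eq_card_walks:
  assumes "i < n" "j < n"
  shows "kernel_pow n (\<lambda>i j. of_bool ((i, j) \<in> E)) m i j
    = real (card {f \<in> {..m} \<rightarrow>\<^sub>E {..<n}. f 0 = i \<and> f m = j \<and> (\<forall>t<m. (f t, f (Suc t)) \<in> E)})"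
    (is "_ = real (card (?W m j))")
  using assms(2)
proof (induction m arbitrary: j)
  case 0
  \<comment> \<open>A walk without steps is the extensional function on \<open>{0}\<close> with
    value \<open>i\<close>, which ends in \<open>j\<close> only if \<open>i = j\<close>.\<close>
  have "?W 0 j = (if i = j then {\<lambda>x. if x = 0 then i else undefined} else {})"
    using assms(1) by (auto simp: PiE_def extensional_def fun_eq_iff)
  then show ?case by simp
next
  case (Suc m)
  have fin: "finite (?W m v)" for v
    by (rule finite_subset[of _ "{..m} \<rightarrow>\<^sub>E {..<n}"]) (auto intro: finite_PiE)
  let ?S = "SIGMA v:{v. v < n \<and> (v, j) \<in> E}. ?W m v"
  have "bij_betw (\<lambda>(v, g). g(Suc m := j)) ?S (?W (Suc m) j)"
  proof (rule bij_betw_byWitness[where f' = "\<lambda>f. (f m, restrict f {..m})"])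
    show "\<forall>z\<in>?S. (\<lambda>f. (f m, restrict f {..m})) ((\<lambda>(v, g). g(Suc m := j)) z) = z"
      by (auto simp: fun_eq_iff PiE_def extensional_def)
    show "\<forall>f\<in>?W (Suc m) j. (\<lambda>(v, g). g(Suc m := j)) (f m, restrict f {..m}) = f"
      by (auto simp: fun_eq_iff PiE_def extensional_def le_Suc_eq)
    show "(\<lambda>(v, g). g(Suc m := j)) ` ?S \<subseteq> ?W (Suc m) j"
      using Suc.prems by (auto simp: PiE_def extensional_def Pi_def le_Suc_eq less_Suc_eq)
    show "(\<lambda>f. (f m, restrict f {..m})) ` ?W (Suc m) j \<subseteq> ?S"
      by (auto simp: PiE_def extensional_def Pi_def le_Suc_eq less_Suc_eq)
  qed
  then have "card (?W (Suc m) j) = card ?S"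
    by (simp only: bij_betw_same_card)
  also have "\<dots> = (\<Sum>v\<in>{v. v < n \<and> (v, j) \<in> E}. card (?W m v))"
    using fin by (intro card_SigmaI) auto
  finally have "real (card (?W (Suc m) j)) = (\<Sum>v\<in>{v\<in>{..<n}. (v, j) \<in> E}. real (card (?W m v)))"
    by (simp only: of_nat_sum lessThan_iff)
  also have "\<dots> = (\<Sum>v<n. if (v, j) \<in> E then real (card (?W m v)) else 0)"
    by (rule sum.inter_filter) simp
  also have "\<dots> = kernel_pow n (\<lambda>i j. of_bool ((i, j) \<in> E)) (Suc m) i j"
    unfolding kernel_pow.simps by (intro sum.cong refl) (simp add: Suc.IH)
  finally show ?case by simp
qed

text \<open>A homomorphism from the cycle is a closed walk with the repeated last vertex cut off;
  the trace groups these walks by their starting vertex.\<close>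

lemma hom_count_cycle_graph_eq_trace:
  assumes T: "pair_graph T" "pverts T = {..<n}" and m: "m \<ge> 2"
  shows "real (hom_count (cycle_graph m) T)
    = (\<Sum>i<n. kernel_pow n (\<lambda>i j. of_bool ((i, j) \<in> parcs T)) m i i)"
proof -
  let ?W = "\<lambda>i. {f \<in> {..m} \<rightarrow>\<^sub>E {..<n}. f 0 = i \<and> f m = i \<and> (\<forall>t<m. (f t, f (Suc t)) \<in> parcs T)}"
  let ?H = "{f \<in> {..<m} \<rightarrow>\<^sub>E {..<n}. \<forall>i<m. (f i, f (Suc i mod m)) \<in> parcs T}"
  have fin: "finite (?W v)" for v
    by (rule finite_subset[of _ "{..m} \<rightarrow>\<^sub>E {..<n}"]) (auto intro: finite_PiE)
  have md: "Suc t mod m = (if Suc t = m then 0 else Suc t)" if "t < m" for t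
    using that by auto
  have "bij_betw (\<lambda>f. (f 0, f(m := f 0))) ?H (SIGMA i:{..<n}. ?W i)"
  proof (rule bij_betw_byWitness[where f' = "\<lambda>(i, g). restrict g {..<m}"])
    show "\<forall>f\<in>?H. (\<lambda>(i, g). restrict g {..<m}) (f 0, f(m := f 0)) = f"
      by (auto simp: fun_eq_iff PiE_def extensional_def)
    show "\<forall>z\<in>SIGMA i:{..<n}. ?W i. (\<lambda>f. (f 0, f(m := f 0))) ((\<lambda>(i, g). restrict g {..<m}) z) = z"
      using m by (auto simp: fun_eq_iff PiE_def extensional_def)
    show "(\<lambda>f. (f 0, f(m := f 0))) ` ?H \<subseteq> (SIGMA i:{..<n}. ?W i)"
      using m md by (auto simp: PiE_def extensional_def Pi_def)
    show "(\<lambda>(i, g). restrict g {..<m}) ` (SIGMA i:{..<n}. ?W i) \<subseteq> ?H"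
      using m by (auto simp: PiE_def extensional_def Pi_def md)
  qed
  then have "card ?H = card (SIGMA i:{..<n}. ?W i)"
    by (rule bij_betw_same_card)
  also have "\<dots> = (\<Sum>i<n. card (?W i))"
    using fin by (intro card_SigmaI) auto
  finally show ?thesis
    unfolding hom_count_def graph_homs_cycle_graph[OF T(1) m] T(2)
    by (simp add: kernel_pow_eq_card_walks)
qed

text \<open>Relabel the vertices as \<open>{..<n}\<close> and divide the adjacency eigenvalues by
  \<open>n\<close>. The sum of the \<open>(x i)\<^sup>2\<close> is then the average degree divided
  by \<open>n\<close>, so the second claim is the eigenvalue bound by the average row sum,
  rescaled.\<close>

lemma hom_density_cycle_graph_spectrum:
  fixes T :: "'b pair_pre_digraph"
  assumes T: "pair_graph T" "pverts T \<noteq> {}"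
  obtains n and x :: "nat \<Rightarrow> real"
  where "\<And>m. m \<ge> 2 \<Longrightarrow> hom_density (cycle_graph m) T = (\<Sum>i<n. x i ^ m)"
    and "\<exists>i<n. (\<Sum>i<n. (x i)\<^sup>2) \<le> \<bar>x i\<bar>"
proof -
  interpret pair_graph T by fact
  define n where "n = card (pverts T)"
  have n: "n > 0" using T(2) by (simp add: n_def card_gt_0_iff)
  obtain h where h: "bij_betw h (pverts T) {..<n}"
    using ex_bij_betw_finite_nat[OF finite_verts] by (auto simp: n_def lessThan_atLeast0)
  define T' where "T' = \<lparr>pverts = {..<n}, parcs = map_prod h h ` parcs T\<rparr>"
  have T': "pair_graph T'" "pverts T' = {..<n}"
    using pair_graph_image[OF T(1) h] by (simp_all add: T'_def)
  interpret T': pair_graph T' by fact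
  define M where "M i j = (of_bool ((i, j) \<in> parcs T') :: real)" for i j
  have sym: "M i j = M j i" for i j
    unfolding M_def using T'.arcs_symmetric by (intro arg_cong[where f = of_bool]) blast
  obtain ev where ev: "\<And>m. (\<Sum>i<n. kernel_pow n M m i i) = (\<Sum>i<n. ev i ^ m)"
    using symmetric_kernel_spectrum[of n M] sym by blast
  define x where "x i = ev i / real n" for i
  have dens: "hom_density (cycle_graph m) T = (\<Sum>i<n. x i ^ m)" if "m \<ge> 2" for m
  proof -
    have "hom_density (cycle_graph m) T = hom_density (cycle_graph m) T'"
      unfolding T'_def by (rule hom_density_image[symmetric, OF T(1) h pair_graph_cycle_graph[OF that]])
    also have "\<dots> = (\<Sum>i<n. ev i ^ m) / real n ^ m"
      using hom_count_cycle_graph_eq_trace[OF T' that] T'(2)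
      by (simp add: hom_density_def ev[symmetric] M_def[abs_def]) (simp add: cycle_graph_def)
    finally show ?thesis by (simp add: x_def power_divide sum_divide_distrib)
  qed
  \<comment> \<open>The entries are 0 or 1 and symmetric, so the trace of the square counts the
    arcs.\<close>
  have M2: "(\<Sum>i<n. \<Sum>j<n. M i j) = (\<Sum>i<n. ev i ^ 2)"
  proof -
    have "(\<Sum>i<n. kernel_pow n M 2 i i) = (\<Sum>i<n. \<Sum>j<n. kernel_pow n M 1 i j * kernel_pow n M 1 j i)"
      unfolding one_add_one[symmetric] by (intro sum.cong refl kernel_pow_add) auto
    also have "\<dots> = (\<Sum>i<n. \<Sum>j<n. M i j * M j i)"
      by (intro sum.cong refl) (simp only: kernel_pow_1 lessThan_iff)
    also have "\<dots> = (\<Sum>i<n. \<Sum>j<n. M i j)"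
    proof (intro sum.cong refl)
      show "M i j * M j i = M i j" for i j
        unfolding sym[of j i] by (simp add: M_def)
    qed
    finally show ?thesis by (simp only: ev)
  qed
  have "\<exists>i<n. (\<Sum>i<n. ev i ^ 2) / real n \<le> \<bar>ev i\<bar>"
    using n M2 by (intro spectrum_ge_average_row_sum[OF _ n _ _ ev] sym)
      (auto intro!: divide_nonneg_nonneg sum_nonneg)
  then obtain i where i: "i < n" "(\<Sum>i<n. ev i ^ 2) / real n \<le> \<bar>ev i\<bar>" by blast
  have "(\<Sum>i<n. (x i)\<^sup>2) = (\<Sum>i<n. ev i ^ 2) / real n / real n"
    by (simp add: x_def power_divide sum_divide_distrib power2_eq_square)
  also have "\<dots> \<le> \<bar>x i\<bar>"
    using divide_right_mono[OF i(2), of "real n"] by (simp add: x_def)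
  finally show thesis
    using that[OF dens] i(1) by blast
qed

text \<open>The interpolation applies to the \<open>\<bar>x i\<bar>\<close>: its assumption
  \<open>sq\<close> holds because a single term already exceeds the edge density.\<close>

lemma cycle_graph_domination:
  fixes k l :: nat
  assumes kl: "k \<ge> 2" "l \<ge> 2" "2 * k \<ge> l"
  shows "4 * real k * (real k - 1) / (2 * real k * real l - 2 * real k - real l)
    \<in> domination_exponents (cycle_graph (2 * k)) (cycle_graph l)" (is "?c \<in> _")
  unfolding domination_exponents_def
proof (intro CollectI allI impI)
  fix T :: "nat pair_pre_digraph"
  assume T: "pair_graph T \<and> pverts T \<noteq> {}"
  then obtain n and x :: "nat \<Rightarrow> real"
    where x: "\<And>m. m \<ge> 2 \<Longrightarrow> hom_density (cycle_graph m) T = (\<Sum>i<n. x i ^ m)"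
      and top: "\<exists>i<n. (\<Sum>i<n. (x i)\<^sup>2) \<le> \<bar>x i\<bar>"
    using hom_density_cycle_graph_spectrum by metis
  obtain i where i: "i < n" "(\<Sum>i<n. (x i)\<^sup>2) \<le> \<bar>x i\<bar>" using top by blast
  have "(\<Sum>i<n. \<bar>x i\<bar> ^ 2) ^ (2 * k) \<le> \<bar>x i\<bar> ^ (2 * k)"
    using i by (intro power_mono) (auto intro: sum_nonneg)
  also have "\<dots> \<le> (\<Sum>i<n. \<bar>x i\<bar> ^ (2 * k))"
    using i by (intro member_le_sum) auto
  finally have le: "(\<Sum>i<n. \<bar>x i\<bar> ^ l) powr ?c \<le> (\<Sum>i<n. \<bar>x i\<bar> ^ (2 * k))"
    by (intro sum_power_interpolation kl) auto
  have c: "?c \<ge> 0"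
    using cycle_exponent_denominator_pos[OF kl(1,2)] kl by simp
  \<comment> \<open>For odd \<open>l\<close> negative eigenvalues may cancel; absolute values only
    enlarge the power sum of exponent \<open>l\<close> and leave the even exponents 2 and
    \<open>2 * k\<close> alone.\<close>
  have "hom_density (cycle_graph l) T powr ?c \<le> (\<Sum>i<n. \<bar>x i\<bar> ^ l) powr ?c"
  proof (intro powr_mono2 c)
    show "hom_density (cycle_graph l) T \<ge> 0" by (simp add: hom_density_def)
    show "hom_density (cycle_graph l) T \<le> (\<Sum>i<n. \<bar>x i\<bar> ^ l)"
      unfolding x[OF kl(2)] by (intro sum_mono) (simp add: power_abs[symmetric])
  qed
  also note le
  also have "(\<Sum>i<n. \<bar>x i\<bar> ^ (2 * k)) = hom_density (cycle_graph (2 * k)) T"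
    using kl by (simp add: x power_even_abs)
  finally show "hom_density (cycle_graph l) T powr ?c \<le> hom_density (cycle_graph (2 * k)) T" .
qed

section \<open>The moment curve graph\<close>

text \<open>The difference of the two vectors is a multiple of the moment curve point with parameter
  \<open>a\<close>. The field of \<open>p\<close> elements is modelled by integers modulo
  \<open>p\<close>. As \<open>a ^ 0 = 1\<close>, coordinate 0 of the difference is the multiplier
  \<open>t\<close> itself.\<close>

definition moment_adj :: "nat \<Rightarrow> nat \<Rightarrow> (nat \<Rightarrow> int) \<Rightarrow> (nat \<Rightarrow> int) \<Rightarrow> bool" where
  "moment_adj p r x y \<longleftrightarrow>
    x \<noteq> y \<and> (\<exists>a t. a \<in> {0..<int p} \<and> (\<forall>i<r. [y i = x i + t * a ^ i] (mod int p)))"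

lemma moment_adj_sym:
  assumes "moment_adj p r x y"
  shows "moment_adj p r y x"
proof -
  obtain a t where a: "a \<in> {0..<int p}" and t: "\<And>i. i < r \<Longrightarrow> [y i = x i + t * a ^ i] (mod int p)"
    using assms unfolding moment_adj_def by metis
  have "[x i = y i + (- t) * a ^ i] (mod int p)" if "i < r" for i
  proof -
    have "[y i - t * a ^ i = x i + t * a ^ i - t * a ^ i] (mod int p)"
      using t[OF that] by (intro cong_diff cong_refl)
    then show ?thesis by (simp add: cong_sym_eq)
  qed
  then show ?thesis using assms a unfolding moment_adj_def by metis
qed

definition moment_graph :: "nat \<Rightarrow> nat \<Rightarrow> (nat \<Rightarrow> int) pair_pre_digraph" where
  "moment_graph p r =
    \<lparr>pverts = {..<r} \<rightarrow>\<^sub>E {0..<int p},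
     parcs = {(x, y). x \<in> {..<r} \<rightarrow>\<^sub>E {0..<int p} \<and> y \<in> {..<r} \<rightarrow>\<^sub>E {0..<int p} \<and> moment_adj p r x y}\<rparr>"

lemma pverts_moment_graph: "pverts (moment_graph p r) = {..<r} \<rightarrow>\<^sub>E {0..<int p}"
  by (simp add: moment_graph_def)

lemma parcs_moment_graph:
  "(x, y) \<in> parcs (moment_graph p r) \<longleftrightarrow>
    x \<in> pverts (moment_graph p r) \<and> y \<in> pverts (moment_graph p r) \<and> moment_adj p r x y"
  by (simp add: moment_graph_def)

lemma pair_graph_moment_graph: "pair_graph (moment_graph p r)"
proof -
  have fin: "finite (pverts (moment_graph p r))"
    unfolding pverts_moment_graph by (intro finite_PiE) auto
  have "finite (parcs (moment_graph p r))"
    by (rule finite_subset[OF _ finite_cartesian_product[OF fin fin]])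
      (auto simp: parcs_moment_graph)
  with fin show ?thesis
    by unfold_locales
      (auto simp: symmetric_def sym_def parcs_moment_graph moment_adj_sym, simp add: moment_adj_def)
qed

lemma card_pverts_moment_graph: "card (pverts (moment_graph p r)) = p ^ r"
  by (simp add: moment_graph_def card_PiE)

section \<open>Linear relations between points of the moment curve\<close>

lemma cong_imp_eq_residue:
  fixes a b :: int
  assumes "[a = b] (mod int p)" "a \<in> {0..<int p}" "b \<in> {0..<int p}"
  shows "a = b"
  using assms by (auto intro: cong_less_imp_eq_int)

text \<open>Any \<open>r\<close> points of the moment curve are linearly independent modulo \<open>p\<close>: pair the relation
  with the polynomial vanishing at all the other parameters.\<close>

lemma moment_relation_class:
  fixes a t :: "nat \<Rightarrow> int"
  assumes p: "prime p" and a: "\<And>j. j < r \<Longrightarrow> a j \<in> {0..<int p}"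
    and rel: "\<And>i. i < r \<Longrightarrow> int p dvd (\<Sum>j<r. t j * a j ^ i)" and m: "m < r"
  shows "int p dvd (\<Sum>j\<in>{j\<in>{..<r}. a j = a m}. t j)"
proof -
  define B where "B = a ` {..<r} - {a m}"
  define g :: "int poly" where "g = (\<Prod>b\<in>B. [:- b, 1:])"
  have B: "finite B" by (simp add: B_def)
  \<comment> \<open>\<open>B\<close> omits \<open>a m\<close>, so \<open>g\<close> has degree below
    \<open>r\<close> and only the given relations, with \<open>i < r\<close>, enter.\<close>
  have "card B < card (a ` {..<r})"
    unfolding B_def using m by (intro psubset_card_mono) auto
  also have "\<dots> \<le> r" using card_image_le[of "{..<r}" a] by simp
  finally have deg: "degree g < r"
    unfolding g_def by (subst degree_prod_eq_sum_degree) auto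
  have gx: "poly g x = (\<Prod>b\<in>B. x - b)" for x
    by (simp add: g_def poly_prod)
  have "(\<Sum>j<r. t j * poly g (a j)) = (\<Sum>j<r. \<Sum>i\<le>degree g. coeff g i * (t j * a j ^ i))"
    by (simp add: poly_altdef sum_distrib_left mult_ac)
  also have "\<dots> = (\<Sum>i\<le>degree g. coeff g i * (\<Sum>j<r. t j * a j ^ i))"
    by (subst sum.swap) (simp add: sum_distrib_left)
  finally have "(\<Sum>j<r. t j * poly g (a j)) = (\<Sum>i\<le>degree g. coeff g i * (\<Sum>j<r. t j * a j ^ i))" .
  moreover have "int p dvd \<dots>"
    using deg by (intro dvd_sum[OF dvd_mult[OF rel]]) auto
  ultimately have "int p dvd (\<Sum>j<r. t j * poly g (a j))" by (simp only:)
  also have "(\<Sum>j<r. t j * poly g (a j)) = (\<Sum>j<r. if a j = a m then t j * poly g (a m) else 0)"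
  proof (intro sum.cong refl)
    fix j assume "j \<in> {..<r}"
    show "t j * poly g (a j) = (if a j = a m then t j * poly g (a m) else 0)"
    proof (cases "a j = a m")
      case False
      then have "a j \<in> B" using \<open>j \<in> {..<r}\<close> by (simp add: B_def)
      then have "poly g (a j) = 0" unfolding gx using B by (auto simp: prod_zero_iff)
      then show ?thesis using False by simp
    qed simp
  qed
  also have "\<dots> = (\<Sum>j\<in>{j\<in>{..<r}. a j = a m}. t j) * poly g (a m)"
    unfolding sum_distrib_right by (rule sum.inter_filter[symmetric]) simp
  finally have "int p dvd (\<Sum>j\<in>{j\<in>{..<r}. a j = a m}. t j) * poly g (a m)" .
  moreover have "\<not> int p dvd poly g (a m)"
  proof
    assume "int p dvd poly g (a m)"
    then obtain b where b: "b \<in> B" "int p dvd a m - b"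
      using p B prime_dvd_prod_iff[of B "int p" "\<lambda>b. a m - b"] by (auto simp: gx)
    then have "[a m = b] (mod int p)" by (simp add: cong_iff_dvd_diff)
    moreover have "b \<in> {0..<int p}" using b a by (auto simp: B_def)
    ultimately have "a m = b" using a[OF m] by (intro cong_imp_eq_residue)
    then show False using b by (simp add: B_def)
  qed
  ultimately show ?thesis
    using p prime_dvd_mult_iff[of "int p"] by simp
qed

text \<open>The step data of closed walks of length \<open>r\<close>: step \<open>j\<close> adds
  \<open>t j\<close> times the point with parameter \<open>a j\<close>, and all steps together add
  up to zero modulo \<open>p\<close>.\<close>

definition moment_relations :: "nat \<Rightarrow> nat \<Rightarrow> ((nat \<Rightarrow> int) \<times> (nat \<Rightarrow> int)) set" where
  "moment_relations p r =
    {(a, t). a \<in> {..<r} \<rightarrow>\<^sub>E {0..<int p} \<and> t \<in> {..<r} \<rightarrow>\<^sub>E {0..<int p} \<and>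
      (\<forall>i<r. int p dvd (\<Sum>j<r. t j * a j ^ i))}"

text \<open>A relation is determined by the partition of the indices into classes of equal parameter,
  the parameter of each class, and all coefficients but the first of each class: that is one
  residue per index.\<close>

lemma card_moment_relations:
  assumes p: "prime p"
  shows "finite (moment_relations p r) \<and> card (moment_relations p r) \<le> r ^ r * p ^ r"
proof -
  let ?C = "({..<r} \<rightarrow>\<^sub>E {..<r}) \<times> ({..<r} \<rightarrow>\<^sub>E {0..<int p})"
  define \<phi> where "\<phi> a j = (LEAST j'. a j' = a j)" for a :: "nat \<Rightarrow> int" and j
  \<comment> \<open>One residue per index: the parameter at the first index of a class, the
    coefficient at every other index.\<close>
  define d where "d z j = (if \<phi> (fst z) j = j then fst z j else snd z j)"
    for z :: "(nat \<Rightarrow> int) \<times> (nat \<Rightarrow> int)" and j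
  define F where "F z = (restrict (\<phi> (fst z)) {..<r}, restrict (d z) {..<r})" for z
  have \<phi>: "a (\<phi> a j) = a j" for a j
    unfolding \<phi>_def by (rule LeastI[where P = "\<lambda>j'. a j' = a j"]) simp
  have \<phi>_le: "\<phi> a j \<le> j" for a j
    unfolding \<phi>_def by (rule Least_le) simp
  have \<phi>_cong: "\<phi> a i = \<phi> a j" if "a i = a j" for a i j
    using that by (simp add: \<phi>_def)
  have "inj_on F (moment_relations p r)"
  proof (rule inj_onI)
    fix z w assume z: "z \<in> moment_relations p r" and w: "w \<in> moment_relations p r" and eq: "F z = F w"
    obtain a t b u where zw: "z = (a, t)" "w = (b, u)" by (cases z, cases w) auto
    have a: "a \<in> {..<r} \<rightarrow>\<^sub>E {0..<int p}" "t \<in> {..<r} \<rightarrow>\<^sub>E {0..<int p}"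
      "\<And>i. i < r \<Longrightarrow> int p dvd (\<Sum>j<r. t j * a j ^ i)"
      and b: "b \<in> {..<r} \<rightarrow>\<^sub>E {0..<int p}" "u \<in> {..<r} \<rightarrow>\<^sub>E {0..<int p}"
      "\<And>i. i < r \<Longrightarrow> int p dvd (\<Sum>j<r. u j * b j ^ i)"
      using z w by (auto simp: zw moment_relations_def)
    have eq\<phi>: "\<phi> a j = \<phi> b j" and eqd: "d (a, t) j = d (b, u) j" if "j < r" for j
      using eq that by (auto simp: F_def zw fun_eq_iff restrict_def split: if_splits)
    have eqa: "a j = b j" if "j < r" for j
    proof -
      have "\<phi> a j < r" using \<phi>_le[of a j] that by simp
      then have "d (a, t) (\<phi> a j) = d (b, u) (\<phi> a j)" by (rule eqd)
      moreover have "\<phi> a (\<phi> a j) = \<phi> a j" "\<phi> b (\<phi> b j) = \<phi> b j" by (rule \<phi>_cong, rule \<phi>)+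
      ultimately have "a (\<phi> a j) = b (\<phi> b j)" using eq\<phi>[OF that] by (simp add: d_def)
      then show ?thesis by (simp add: \<phi>)
    qed
    have eqt': "t j = u j" if "j < r" "\<phi> a j \<noteq> j" for j
      using eqd[OF that(1)] eq\<phi>[OF that(1)] that by (simp add: d_def)
    have eqt: "t j = u j" if j: "j < r" for j
    proof (cases "\<phi> a j = j")
      \<comment> \<open>The coefficient at the first index is not recorded. It is recovered modulo
        \<open>p\<close>, since the coefficients of the class sum to zero and all others
        agree.\<close>
      case True
      let ?J = "{i\<in>{..<r}. a i = a j}"
      have J: "{i\<in>{..<r}. b i = b j} = ?J" using eqa j by auto
      have s: "sum t ?J = t j + sum t (?J - {j})" "sum u ?J = u j + sum u (?J - {j})"
        using j by (auto intro!: sum.remove)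
      have rest: "sum t (?J - {j}) = sum u (?J - {j})"
      proof (intro sum.cong refl eqt')
        fix i assume "i \<in> ?J - {j}"
        then show "i < r" "\<phi> a i \<noteq> i" using \<phi>_cong[of a i j] True by auto
      qed
      have "int p dvd sum t ?J"
        by (rule moment_relation_class[OF p _ a(3) j]) (use a(1) in \<open>auto simp: PiE_iff\<close>)
      moreover have "int p dvd sum u ?J"
        unfolding J[symmetric]
        by (rule moment_relation_class[OF p _ b(3) j]) (use b(1) in \<open>auto simp: PiE_iff\<close>)
      ultimately have "int p dvd sum t ?J - sum u ?J" by (rule dvd_diff)
      then have "int p dvd t j - u j" unfolding s rest by simp
      then have "[t j = u j] (mod int p)" by (simp add: cong_iff_dvd_diff)
      then show ?thesis 
        by (rule cong_imp_eq_residue[OF _ PiE_mem[OF a(2)] PiE_mem[OF b(2)]]) (use j in auto)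
    qed (use eqt' j in simp)
    have "a = b" using eqa a(1) b(1) by (intro PiE_ext[where k = "{..<r}"]) auto
    moreover have "t = u" using eqt a(2) b(2) by (intro PiE_ext[where k = "{..<r}"]) auto
    ultimately show "z = w" by (simp add: zw)
  qed
  moreover have "F ` moment_relations p r \<subseteq> ?C"
  proof
    fix y assume "y \<in> F ` moment_relations p r"
    then obtain a t where at: "(a, t) \<in> moment_relations p r" "y = F (a, t)" by auto
    have "\<phi> a j < r" if "j < r" for j using \<phi>_le[of a j] that by simp
    then show "y \<in> ?C" using at by (auto simp: F_def moment_relations_def d_def PiE_iff)
  qed
  moreover have "finite ?C" by (intro finite_cartesian_product finite_PiE) auto
  ultimately have "finite (moment_relations p r)" "card (moment_relations p r) \<le> card ?C"
    by (auto intro: inj_on_finite card_inj_on_le)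
  then show ?thesis by (simp add: card_cartesian_product card_PiE)
qed

text \<open>A closed walk is determined by its starting vertex and its step data, and the latter
  form a relation of length \<open>r\<close>. This gives \<open>p ^ r\<close> starting vertices
  times the number of relations.\<close>

lemma hom_count_moment_graph_le:
  assumes p: "prime p" and r: "r \<ge> 2"
  shows "hom_count (cycle_graph r) (moment_graph p r) \<le> p ^ r * (r ^ r * p ^ r)"
proof -
  let ?V = "{..<r} \<rightarrow>\<^sub>E {0..<int p}"
  let ?H = "graph_homs (cycle_graph r) (moment_graph p r)"
  have p0: "p > 0" using p by (simp add: prime_gt_0_nat)
  have H: "?H = {f \<in> {..<r} \<rightarrow>\<^sub>E ?V. \<forall>j<r. (f j, f (Suc j mod r)) \<in> parcs (moment_graph p r)}"
    using graph_homs_cycle_graph[OF pair_graph_moment_graph r] by (simp only: pverts_moment_graph)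
  define step where "step f z \<longleftrightarrow>
      (\<forall>j<r. \<forall>i<r. [f (Suc j mod r) i = f j i + snd z j * fst z j ^ i] (mod int p))"
    for f :: "nat \<Rightarrow> nat \<Rightarrow> int" and z :: "(nat \<Rightarrow> int) \<times> (nat \<Rightarrow> int)"
  have ex: "\<exists>z\<in>moment_relations p r. step f z" if f: "f \<in> ?H" for f
  proof -
    have "\<forall>j\<in>{..<r}. \<exists>a t. a \<in> {0..<int p} \<and> (\<forall>i<r. [f (Suc j mod r) i = f j i + t * a ^ i] (mod int p))"
    proof
      fix j assume "j \<in> {..<r}"
      then have "(f j, f (Suc j mod r)) \<in> parcs (moment_graph p r)" using f unfolding H by blast
      then show "\<exists>a t. a \<in> {0..<int p} \<and>
          (\<forall>i<r. [f (Suc j mod r) i = f j i + t * a ^ i] (mod int p))"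
        unfolding parcs_moment_graph moment_adj_def by metis
    qed
    then obtain a t where at: "\<And>j. j < r \<Longrightarrow> a j \<in> {0..<int p}"
      "\<And>j i. j < r \<Longrightarrow> i < r \<Longrightarrow> [f (Suc j mod r) i = f j i + t j * a j ^ i] (mod int p)"
      unfolding bchoice_iff by auto
    define a' where "a' = restrict a {..<r}"
    define t' where "t' = restrict (\<lambda>j. t j mod int p) {..<r}"
    have step: "[f (Suc j mod r) i = f j i + t' j * a' j ^ i] (mod int p)" if "j < r" "i < r" for i j
    proof -
      have "[f j i + t j * a j ^ i = f j i + t' j * a' j ^ i] (mod int p)"
        using that by (intro cong_add cong_mult cong_refl) (auto simp: a'_def t'_def cong_def)
      then show ?thesis using at(2)[OF that] cong_trans by blast
    qed
    have "int p dvd (\<Sum>j<r. t' j * a' j ^ i)" if i: "i < r" for i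
    proof -
      have "[(\<Sum>j<r. f (Suc j mod r) i) = (\<Sum>j<r. f j i + t' j * a' j ^ i)] (mod int p)"
        using step i by (intro cong_sum) auto
      \<comment> \<open>The walk closes up: shifting the index cyclically permutes the terms, so the
        steps cancel in total.\<close>
      moreover have "(\<Sum>j<r. f (Suc j mod r) i) = (\<Sum>j<r. f j i)"
      proof -
        obtain q where q: "r = Suc q" using r by (cases r) auto
        have "(\<Sum>j<r. f (Suc j mod r) i) = (\<Sum>j<q. f (Suc j) i) + f 0 i"
          unfolding q by simp
        also have "\<dots> = (\<Sum>j<r. f j i)" unfolding q sum.lessThan_Suc_shift by simp
        finally show ?thesis .
      qed
      ultimately have "int p dvd (\<Sum>j<r. f j i) - (\<Sum>j<r. f j i + t' j * a' j ^ i)"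
        by (simp add: cong_iff_dvd_diff)
      then show ?thesis by (simp add: sum.distrib)
    qed
    then have "(a', t') \<in> moment_relations p r"
      using at(1) p0 by (auto simp: moment_relations_def a'_def t'_def)
    then show ?thesis using step by (auto simp: step_def intro!: bexI[of _ "(a', t')"])
  qed
  \<comment> \<open>Any choice of step data will do, because \<open>f\<close> is rebuilt from
    \<open>f 0\<close> and \<open>rel f\<close>.\<close>
  define rel where "rel f = (SOME z. z \<in> moment_relations p r \<and> step f z)" for f
  have rel: "rel f \<in> moment_relations p r" "step f (rel f)" if "f \<in> ?H" for f
    using someI_ex[of "\<lambda>z. z \<in> moment_relations p r \<and> step f z"] ex[OF that] by (auto simp: rel_def)
  have inj: "inj_on (\<lambda>f. (f 0, rel f)) ?H"
  proof (rule inj_onI)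
    fix f g assume f: "f \<in> ?H" and g: "g \<in> ?H" and eq: "(f 0, rel f) = (g 0, rel g)"
    have fV: "f j \<in> ?V" "g j \<in> ?V" if "j < r" for j
      using f g that unfolding H by auto
    have "f j = g j" if "j < r" for j
      using that
    proof (induction j)
      case 0
      then show ?case using eq by simp
    next
      case (Suc j)
      show ?case
      proof (rule PiE_ext[OF fV[OF Suc.prems]])
        fix i assume i: "i \<in> {..<r}"
        have same: "f j = g j" "rel f = rel g" using Suc eq by simp_all
        have f': "[f (Suc j) i = f j i + snd (rel f) j * fst (rel f) j ^ i] (mod int p)"
          using rel(2)[OF f, unfolded step_def, rule_format, of j i] Suc.prems i by simp
        have g': "[g (Suc j) i = g j i + snd (rel g) j * fst (rel g) j ^ i] (mod int p)"
          using rel(2)[OF g, unfolded step_def, rule_format, of j i] Suc.prems i by simp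
        have "[f (Suc j) i = g (Suc j) i] (mod int p)"
          using cong_trans[OF f' cong_sym[OF g'[folded same]]] .
        then show "f (Suc j) i = g (Suc j) i"
          by (rule cong_imp_eq_residue[OF _ PiE_mem[OF fV(1)[OF Suc.prems] i]
                PiE_mem[OF fV(2)[OF Suc.prems] i]])
      qed
    qed
    then show "f = g" using f g unfolding H by (intro PiE_ext[where k = "{..<r}"]) auto
  qed
  have "(\<lambda>f. (f 0, rel f)) ` ?H \<subseteq> ?V \<times> moment_relations p r"
    using rel(1) r unfolding H by auto
  then have "card ?H \<le> card (?V \<times> moment_relations p r)"
    using card_moment_relations[OF p] by (intro card_inj_on_le[OF inj] finite_cartesian_product finite_PiE) auto
  also have "\<dots> = p ^ r * card (moment_relations p r)"
    by (simp add: card_cartesian_product card_PiE)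
  also have "\<dots> \<le> p ^ r * (r ^ r * p ^ r)"
    using card_moment_relations[OF p] by simp
  finally show ?thesis by (simp add: hom_count_def)
qed

text \<open>Only walks inside one line are counted: a start \<open>x\<close>, a direction
  \<open>a\<close>, and pairwise distinct positions along the line, the first of them 0.\<close>

lemma hom_count_moment_graph_ge:
  assumes p: "prime p" and r: "r \<ge> 2" and l: "l \<ge> 2"
  shows "p ^ r * (p * (p div l) ^ (l - 1)) \<le> hom_count (cycle_graph l) (moment_graph p r)"
proof -
  let ?V = "{..<r} \<rightarrow>\<^sub>E {0..<int p}"
  let ?H = "graph_homs (cycle_graph l) (moment_graph p r)"
  have p0: "p > 0" using p by (simp add: prime_gt_0_nat)
  have H: "?H = {f \<in> {..<l} \<rightarrow>\<^sub>E ?V. \<forall>j<l. (f j, f (Suc j mod l)) \<in> parcs (moment_graph p r)}"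
    using graph_homs_cycle_graph[OF pair_graph_moment_graph l] by (simp only: pverts_moment_graph)
  define m where "m = p div l"
  \<comment> \<open>Positions come from disjoint blocks of length \<open>p div l\<close> below
    \<open>p\<close>, which makes them distinct modulo \<open>p\<close>. Block 0 is reserved for the
    start.\<close>
  define \<T> where "\<T> = (\<Pi>\<^sub>E j\<in>{1..<l}. {j * m..<Suc j * m})"
  define T where "T t j = (if j = 0 then 0 else int (t j))" for t :: "nat \<Rightarrow> nat" and j :: nat
  define F where "F = (\<lambda>(x, a, t). restrict (\<lambda>j. restrict (\<lambda>i. (x i + T t j * a ^ i) mod int p) {..<r}) {..<l})"
  have Tp: "T t j \<in> {0..<int p}" if "t \<in> \<T>" "j < l" for t j
  proof (cases "j = 0")
    case False
    then have "t j \<in> {j * m..<Suc j * m}" using that by (auto simp: \<T>_def)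
    moreover have "Suc j * m \<le> l * m" using that by (intro mult_right_mono) auto
    moreover have "l * m \<le> p" by (simp add: m_def)
    ultimately have "t j < p" by simp
    then show ?thesis using False by (simp add: T_def)
  qed (use p0 in \<open>simp add: T_def\<close>)
  have Tlt: "T t i < T t j" if t: "t \<in> \<T>" and ij: "i < j" "j < l" for t i j
  proof -
    have tj: "t j \<in> {j * m..<Suc j * m}" using t ij by (auto simp: \<T>_def)
    then have m: "m > 0" by (cases m) auto
    show ?thesis
    proof (cases "i = 0")
      case True
      have "0 < j * m" using m ij by simp
      also have "j * m \<le> t j" using tj by simp
      finally have "0 < t j" .
      then show ?thesis using True ij by (simp add: T_def)
    next
      case False
      then have "t i < Suc i * m" using t ij by (auto simp: \<T>_def)
      also have "\<dots> \<le> j * m" using ij by (intro mult_right_mono) auto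
      finally show ?thesis using tj False ij by (auto simp: T_def)
    qed
  qed
  have Tinj: "T t i \<noteq> T t j" if "t \<in> \<T>" "i < l" "j < l" "i \<noteq> j" for t i j
    using Tlt[OF that(1), of i j] Tlt[OF that(1), of j i] that by (cases "i < j") auto
  have F: "F (x, a, t) j i = (x i + T t j * a ^ i) mod int p" if "j < l" "i < r" for x a t j i
    using that by (simp add: F_def)
  have mem: "F (x, a, t) \<in> ?H" if x: "x \<in> ?V" and a: "a \<in> {0..<int p}" and t: "t \<in> \<T>" for x a t
    unfolding H
  proof (intro CollectI conjI allI impI)
    let ?f = "F (x, a, t)"
    show f: "?f \<in> {..<l} \<rightarrow>\<^sub>E ?V" using p0 by (auto simp: F_def)
    fix j assume j: "j < l"
    define j' where "j' = Suc j mod l"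
    have j': "j' < l" "j' \<noteq> j"
      using j l by (auto simp: j'_def mod_Suc)
    have cong: "[?f j' i = ?f j i + (T t j' - T t j) * a ^ i] (mod int p)" if "i < r" for i
    proof -
      have "[?f j' i = x i + T t j' * a ^ i] (mod int p)"
        using j' that by (simp add: F cong_def)
      also have "x i + T t j' * a ^ i = x i + T t j * a ^ i + (T t j' - T t j) * a ^ i"
        by (simp add: algebra_simps)
      also have "[\<dots> = ?f j i + (T t j' - T t j) * a ^ i] (mod int p)"
        using j that by (intro cong_add cong_refl) (simp add: F cong_def)
      finally show ?thesis .
    qed
    have "?f j \<noteq> ?f j'"
    proof
      assume "?f j = ?f j'"
      then have "[x 0 + T t j = x 0 + T t j'] (mod int p)"
        using F[OF j, of 0 x a t] F[OF j'(1), of 0 x a t] r by (simp add: cong_def)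
      then have "[T t j = T t j'] (mod int p)" by (simp add: cong_add_lcancel)
      then have "T t j = T t j'" using Tp[OF t] j j' by (intro cong_imp_eq_residue)
      then show False using Tinj[OF t] j j' by metis
    qed
    moreover have "?f j \<in> ?V" "?f j' \<in> ?V" using f j j' by auto
    ultimately show "(?f j, ?f (Suc j mod l)) \<in> parcs (moment_graph p r)"
      using a cong unfolding j'_def[symmetric] parcs_moment_graph pverts_moment_graph moment_adj_def
      by metis
  qed
  have "inj_on F (?V \<times> {0..<int p} \<times> \<T>)"
  proof (rule inj_onI)
    fix z w assume z: "z \<in> ?V \<times> {0..<int p} \<times> \<T>" and w: "w \<in> ?V \<times> {0..<int p} \<times> \<T>"
      and eq: "F z = F w"
    obtain x a t y b u where zw: "z = (x, a, t)" "w = (y, b, u)" by (cases z, cases w) auto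
    have x: "x \<in> ?V" "y \<in> ?V" and a: "a \<in> {0..<int p}" "b \<in> {0..<int p}"
      and t: "t \<in> \<T>" "u \<in> \<T>"
      using z w unfolding zw by blast+
    have eq': "[x i + T t j * a ^ i = y i + T u j * b ^ i] (mod int p)" if "j < l" "i < r" for i j
      using F[OF that, of x a t] F[OF that, of y b u] eq by (simp add: zw cong_def)
    have xy: "x = y"
    proof (rule PiE_ext[OF x])
      fix i assume i: "i \<in> {..<r}"
      then have "[x i = y i] (mod int p)" using eq'[of 0 i] l by (simp add: T_def)
      then show "x i = y i"
        by (rule cong_imp_eq_residue[OF _ PiE_mem[OF x(1) i] PiE_mem[OF x(2) i]])
    qed
    \<comment> \<open>Coordinate 0 reads off the position on the line.\<close>
    have T_eq: "T t j = T u j" if "j < l" for j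
    proof -
      have "[T t j = T u j] (mod int p)" using eq'[OF that, of 0] r by (simp add: xy cong_add_lcancel)
      then show ?thesis by (rule cong_imp_eq_residue[OF _ Tp[OF t(1) that] Tp[OF t(2) that]])
    qed
    have "t = u"
    proof (rule PiE_ext[OF t[unfolded \<T>_def]])
      show "t j = u j" if "j \<in> {1..<l}" for j using T_eq[of j] that by (simp add: T_def)
    qed
    \<comment> \<open>Coordinate 1 contains the position times \<open>a\<close>, and the position at
      index 1 is invertible modulo \<open>p\<close>.\<close>
    moreover have "a = b"
    proof -
      have T1: "0 < T t 1" "T t 1 < int p"
        using Tlt[OF t(1), of 0 1] Tp[OF t(1), of 1] l by (auto simp: T_def)
      then have "\<not> int p dvd T t 1" using zdvd_imp_le by fastforce
      then have cop: "coprime (T t 1) (int p)"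
        using p by (metis coprime_commute prime_imp_coprime prime_nat_int_transfer)
      have "[T t 1 * a = T t 1 * b] (mod int p)"
        using eq'[of 1 1] r l T_eq[of 1] by (simp add: xy cong_add_lcancel)
      then have "[a = b] (mod int p)" using cop by (simp add: cong_mult_lcancel)
      then show ?thesis by (rule cong_imp_eq_residue[OF _ a])
    qed
    ultimately show "z = w" by (simp add: zw xy)
  qed
  moreover have "F ` (?V \<times> {0..<int p} \<times> \<T>) \<subseteq> ?H" using mem by auto
  moreover have "finite ?H"
    unfolding H by (rule finite_subset[of _ "{..<l} \<rightarrow>\<^sub>E ?V"]) (auto intro!: finite_PiE)
  ultimately have "card (?V \<times> {0..<int p} \<times> \<T>) \<le> card ?H" by (rule card_inj_on_le)
  moreover have "card \<T> = m ^ (l - 1)" by (simp add: \<T>_def card_PiE)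
  ultimately show ?thesis
    by (simp add: card_cartesian_product card_PiE hom_count_def m_def)
qed

section \<open>The lower bound\<close>

lemma hom_density_moment_graph_le:
  assumes p: "prime p" and r: "r \<ge> 2"
  shows "hom_density (cycle_graph r) (moment_graph p r)
    \<le> real r ^ r * real p powr - (real r * real r - 2 * real r)"
proof -
  have p0: "real p > 0" using p by (simp add: prime_gt_0_nat)
  have "hom_density (cycle_graph r) (moment_graph p r)
      = real (hom_count (cycle_graph r) (moment_graph p r)) / real p powr (real r * real r)"
    using p0 by (simp add: hom_density_def card_pverts_moment_graph cycle_graph_def powr_realpow
        flip: power_mult of_nat_mult)
  also have "\<dots> \<le> real (p ^ r * (r ^ r * p ^ r)) / real p powr (real r * real r)"
    using hom_count_moment_graph_le[OF assms] by (intro divide_right_mono) (simp_all only: of_nat_le_iff powr_ge_zero)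
  also have "real (p ^ r * (r ^ r * p ^ r)) = real r ^ r * real p powr (2 * real r)"
    unfolding mult_2 powr_add powr_realpow[OF p0] by simp
  also have "real r ^ r * real p powr (2 * real r) / real p powr (real r * real r)
      = real r ^ r * real p powr - (real r * real r - 2 * real r)"
    by (simp add: powr_diff)
  finally show ?thesis .
qed

lemma hom_density_moment_graph_ge:
  assumes p: "prime p" and r: "r \<ge> 2" and l: "l \<ge> 2" and pl: "p \<ge> l"
  shows "1 / (2 * real l) ^ (l - 1) * real p powr - (real r * real l - real r - real l)
    \<le> hom_density (cycle_graph l) (moment_graph p r)"
proof -
  have p0: "real p > 0" using p by (simp add: prime_gt_0_nat)
  \<comment> \<open>With \<open>q = p div l \<ge> 1\<close> we have
    \<open>p < l * (q + 1) \<le> 2 * l * q\<close>.\<close>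
  have div: "real p / (2 * real l) \<le> real (p div l)"
  proof -
    have "p div l \<ge> 1" using pl l by (simp add: div_greater_zero_iff Suc_le_eq)
    then have "l \<le> l * (p div l)" by simp
    moreover have "p < l * (p div l) + l" using l by (metis add.commute dividend_less_times_div gr0I not_numeral_le_zero mult.commute)
    ultimately have "real p \<le> real (2 * (l * (p div l)))" by (intro of_nat_mono) linarith
    then show ?thesis using l by (simp add: field_simps)
  qed
  have "1 / (2 * real l) ^ (l - 1) * real p powr - (real r * real l - real r - real l)
      = 1 / (2 * real l) ^ (l - 1) * real p powr (real r + 1 + real (l - 1)) / real p powr (real r * real l)"
  proof -
    have "- (real r * real l - real r - real l) = real r + 1 + real (l - 1) - real r * real l"
      using l by (simp add: of_nat_diff)
    then show ?thesis by (simp only: powr_diff times_divide_eq_right)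
  qed
  also have "\<dots> = real p ^ r * (real p * (real p / (2 * real l)) ^ (l - 1)) / real p powr (real r * real l)"
    using p0 by (simp add: powr_add powr_realpow power_divide)
  also have "\<dots> \<le> real p ^ r * (real p * real (p div l) ^ (l - 1)) / real p powr (real r * real l)"
    using div by (intro divide_right_mono mult_left_mono power_mono) auto
  also have "\<dots> \<le> real (hom_count (cycle_graph l) (moment_graph p r)) / real p powr (real r * real l)"
    using hom_count_moment_graph_ge[OF p r l, folded of_nat_le_iff[where 'a = real]]
    by (intro divide_right_mono) simp_all
  also have "\<dots> = hom_density (cycle_graph l) (moment_graph p r)"
    using p0 by (simp add: hom_density_def card_pverts_moment_graph cycle_graph_def powr_realpow
        flip: power_mult of_nat_mult)
  finally show ?thesis .
qed

lemma hom_density_le_1: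
  assumes "finite (pverts H)" "finite (pverts T)"
  shows "hom_density H T \<le> 1"
proof -
  have "hom_count H T \<le> card (pverts H \<rightarrow>\<^sub>E pverts T)"
    unfolding hom_count_def graph_homs_def using assms by (intro card_mono finite_PiE) auto
  then have "real (hom_count H T) \<le> real (card (pverts T)) ^ card (pverts H)"
    using assms by (simp add: card_PiE flip: of_nat_power)
  then show ?thesis by (auto simp: hom_density_def divide_le_eq_1)
qed

text \<open>In the moment curve graph with \<open>r = 2 * k\<close> the density of the
  \<open>l\<close>-cycle is at least \<open>C * p powr - D\<close> and that of the
  \<open>r\<close>-cycle at most \<open>r ^ r * p powr - A\<close>. An exponent below
  \<open>A / D\<close>, which is the claimed value, would keep a positive power of \<open>p\<close>
  bounded over all large primes.\<close>

lemma domination_exponents_ge: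
  fixes k l :: nat
  assumes kl: "k \<ge> 2" "l \<ge> 2" and c: "c \<in> domination_exponents (cycle_graph (2 * k)) (cycle_graph l)"
  shows "4 * real k * (real k - 1) / (2 * real k * real l - 2 * real k - real l) \<le> c"
proof (rule ccontr)
  define r where "r = 2 * k"
  define D where "D = real r * real l - real r - real l"
  define A where "A = real r * real r - 2 * real r"
  define C where "C = 1 / (2 * real l) ^ (l - 1)"
  assume neg: "\<not> ?thesis"
  have D: "D > 0"
    using cycle_exponent_denominator_pos[OF kl] by (simp add: D_def r_def)
  have C: "C > 0" using kl by (simp add: C_def)
  have "A = 4 * real k * (real k - 1)" by (simp add: A_def r_def algebra_simps)
  with neg have cA: "c < A / D" and A: "A > 0" using kl by (simp_all add: D_def r_def)
  \<comment> \<open>Monotonicity in the base needs a nonnegative exponent. Replacing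
    \<open>c\<close> by \<open>c'\<close> is harmless: the density lies between 0 and 1, so the
    larger exponent gives a smaller power, and \<open>A / D\<close> is positive.\<close>
  define c' where "c' = max c 0"
  have c': "c' \<ge> 0" "c \<le> c'" "c' < A / D" using cA A D by (auto simp: c'_def)
  define e where "e = A - D * c'"
  have e: "e > 0" using c' D by (simp add: e_def pos_less_divide_eq mult.commute)
  define K where "K = real r ^ r / C powr c'"
  have bound: "real p powr e \<le> K" if p: "prime p" "p \<ge> l" for p
  proof -
    let ?G = "moment_graph p r"
    have p0: "real p > 0" using p by (simp add: prime_gt_0_nat)
    have r: "r \<ge> 2" using kl by (simp add: r_def)
    interpret G: pair_graph ?G by (rule pair_graph_moment_graph)
    \<comment> \<open>Membership of \<open>c\<close> speaks of graphs on natural numbers, so the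
      moment curve graph is relabelled first.\<close>
    obtain h where h: "bij_betw h (pverts ?G) {..<card (pverts ?G)}"
      using ex_bij_betw_finite_nat[OF G.finite_verts] by (auto simp: lessThan_atLeast0)
    let ?T = "\<lparr>pverts = {..<card (pverts ?G)}, parcs = map_prod h h ` parcs ?G\<rparr>"
    have "pair_graph ?T" by (rule pair_graph_image[OF pair_graph_moment_graph h])
    moreover have "pverts ?T \<noteq> {}" using p0 by (simp add: card_pverts_moment_graph lessThan_empty_iff)
    ultimately have "hom_density (cycle_graph l) ?T powr c \<le> hom_density (cycle_graph r) ?T"
      using c unfolding domination_exponents_def r_def by blast
    then have dom: "hom_density (cycle_graph l) ?G powr c \<le> hom_density (cycle_graph r) ?G"
      using hom_density_image[OF pair_graph_moment_graph h pair_graph_cycle_graph] r kl by simp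
    have ge: "C * real p powr - D \<le> hom_density (cycle_graph l) ?G"
      using hom_density_moment_graph_ge[OF p(1) r kl(2) p(2)] by (simp add: C_def D_def)
    have pos: "C * real p powr - D > 0" using C p0 by simp
    have "C powr c' * real p powr - (D * c') = (C * real p powr - D) powr c'"
      using C by (simp add: powr_mult powr_powr)
    also have "\<dots> \<le> hom_density (cycle_graph l) ?G powr c'"
      using ge pos c' by (intro powr_mono2) auto
    also have "\<dots> \<le> hom_density (cycle_graph l) ?G powr c"
      using ge pos c' by (intro powr_mono' hom_density_le_1) (auto simp: cycle_graph_def)
    also note dom
    also have "hom_density (cycle_graph r) ?G \<le> real r ^ r * real p powr - A"
      using hom_density_moment_graph_le[OF p(1) r] by (simp add: A_def)
    finally have "C powr c' * real p powr - (D * c') * real p powr A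
        \<le> real r ^ r * real p powr - A * real p powr A"
      by (intro mult_right_mono) auto
    then have "C powr c' * real p powr e \<le> real r ^ r"
      using p0 by (simp add: e_def mult.assoc flip: powr_add)
    then show ?thesis using C by (simp add: K_def pos_le_divide_eq mult.commute)
  qed
  \<comment> \<open>\<open>K\<close> and \<open>e\<close> do not depend on \<open>p\<close>, so a
    prime beyond \<open>K powr (1 / e)\<close> violates \<open>bound\<close>.\<close>
  obtain p where p: "prime p" "p > max l (nat \<lceil>K powr (1 / e)\<rceil>)"
    using bigger_prime by blast
  have K: "K > 0" using C kl by (simp add: K_def r_def)
  have "K powr (1 / e) < real p" using p(2) by linarith
  then have "(K powr (1 / e)) powr e < real p powr e" using e by (intro powr_less_mono2) auto
  moreover have "(K powr (1 / e)) powr e = K" using e K by (simp add: powr_powr)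
  moreover have "real p powr e \<le> K" using bound p by simp
  ultimately show False by simp
qed

theorem theorem4p1:
  fixes k l :: nat
  assumes "k \<ge> 2" and "l \<ge> 2" and "2 * k \<ge> l"
  shows "(\<exists>m \<in> domination_exponents (cycle_graph (2 * k)) (cycle_graph l).
            \<forall>c \<in> domination_exponents (cycle_graph (2 * k)) (cycle_graph l). m \<le> c) \<and>
         domination_exponent (cycle_graph (2 * k)) (cycle_graph l) =
           4 * real k * (real k - 1) / (2 * real k * real l - 2 * real k - real l)"
proof -
  note mem = cycle_graph_domination[OF assms]
  note least = domination_exponents_ge[OF assms(1,2)]
  have "domination_exponent (cycle_graph (2 * k)) (cycle_graph l) =
      4 * real k * (real k - 1) / (2 * real k * real l - 2 * real k - real l)"
    unfolding domination_exponent_def by (rule Least_equality, rule mem, rule least)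
  with mem least show ?thesis by blast
qed

end
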